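(* Let $V$ be a finite-dimensional representation of a group $G$ over a field $k$. The set of Lie elements $\mathcal{L}(V)\subset k[G]$ is a Lie subalgebra of $k[G]$, where $k[G]$ carries the commutator bracket $[p,q]=pq-qp$.
   Context: For $g\in G$ and $m\ge 1$ define linear operators $\mathcal{G}_m\langle g\rangle,\mathcal{A}_m\langle g\rangle$ on the exterior power $V^{\wedge m}$ by $$\mathcal{G}_m\langle g\rangle(v_1\wedge\dots\wedge v_m)=g(v_1)\wedge\dots\wedge g(v_m),$$ $$\mathcal{A}_m\langle g\rangle(v_1\wedge\dots\wedge v_m)=\sum_{p=1}^m v_1\wedge\dots\wedge g(v_p)\wedge\dots\wedge v_m,$$ and for $m=0$ (with $V^{\wedge 0}=k$) put $\mathcal{G}_0\langle g\rangle=\mathrm{Id}$, $\mathcal{A}_0\langle g\rangle=0$. Extend $\mathcal{G}_m,\mathcal{A}_m$ by linearity to maps $k[G]\to\mathrm{End}(V^{\wedge m})$ on the group algebra. An element $x\in k[G]$ is a Lie element (with respect to $V$) if $\mathcal{G}_m\langle x\rangle=\mathcal{A}_m\langle x\rangle$ for all $m=0,1,\dots,\dim V$. The set of Lie elements is $\mathcal{L}(V)\subset k[G]$. *)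

theory Defs
  imports Complex_Main "HOL-Library.Poly_Mapping" "HOL-Library.FuncSet"
begin

text \<open>
  Groups are types of class \<open>group_add\<close>, the library's class of not necessarily commutative
  groups, which is written additively: \<open>g + h\<close> is the product and \<open>0\<close> the unit of the group.
  With this reading \<open>'g \<Rightarrow>\<^sub>0 'k\<close> is the group algebra: its multiplication in
  \<open>HOL-Library.Poly_Mapping\<close> is convolution, so the element \<open>Poly_Mapping.single g 1\<close> is \<open>g\<close> and
  \<open>single g 1 * single h 1 = single (g + h) 1\<close>.
\<close>

definition pm_scale :: "'k::field \<Rightarrow> ('a \<Rightarrow>\<^sub>0 'k) \<Rightarrow> ('a \<Rightarrow>\<^sub>0 'k)"
  where "pm_scale c f = Poly_Mapping.map ((*) c) f"

definition lin_ext :: "('a \<Rightarrow> ('b \<Rightarrow>\<^sub>0 'k)) \<Rightarrow> ('a \<Rightarrow>\<^sub>0 'k::field) \<Rightarrow> ('b \<Rightarrow>\<^sub>0 'k)"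
  where "lin_ext \<phi> f = (\<Sum>a\<in>Poly_Mapping.keys f. pm_scale (Poly_Mapping.lookup f a) (\<phi> a))"

locale fd_representation = vector_space scale
  for scale :: "'k::field \<Rightarrow> 'v::ab_group_add \<Rightarrow> 'v" +
  fixes \<rho> :: "'g::group_add \<Rightarrow> 'v \<Rightarrow> 'v"
  assumes finite_dim: "\<exists>B. finite_dimensional_vector_space scale B"
    and rep_linear: "Vector_Spaces.linear scale scale (\<rho> g)"
    and rep_unit: "\<rho> 0 = id"
    and rep_mult: "\<rho> (g + h) = \<rho> g \<circ> \<rho> h"

text \<open>
  The \<open>m\<close>-th exterior power is the vector space generated by symbols
  \<open>v\<^sub>1 \<and> \<dots> \<and> v\<^sub>m\<close>, here the lists \<open>[v\<^sub>1, \<dots>, v\<^sub>m]\<close>, subject to multilinearity and to the vanishing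
  of symbols with two equal entries. Its elements are equivalence classes in the free vector space.
\<close>

definition free_pow :: "nat \<Rightarrow> ('v list \<Rightarrow>\<^sub>0 'k::field) set"
  where "free_pow m = {f. \<forall>vs\<in>Poly_Mapping.keys f. length vs = m}"

inductive_set ext_gens ::
    "('k::field \<Rightarrow> 'v::ab_group_add \<Rightarrow> 'v) \<Rightarrow> nat \<Rightarrow> ('v list \<Rightarrow>\<^sub>0 'k) set"
  for scale :: "'k::field \<Rightarrow> 'v::ab_group_add \<Rightarrow> 'v" and m :: nat
where
  add: "length vs = m \<Longrightarrow> i < m \<Longrightarrow>
      Poly_Mapping.single (vs[i := a + b]) 1
        - (Poly_Mapping.single (vs[i := a]) 1 + Poly_Mapping.single (vs[i := b]) 1)
      \<in> ext_gens scale m"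
| scale: "length vs = m \<Longrightarrow> i < m \<Longrightarrow>
      Poly_Mapping.single (vs[i := scale c a]) 1
        - pm_scale c (Poly_Mapping.single (vs[i := a]) 1)
      \<in> ext_gens scale m"
| alt: "length vs = m \<Longrightarrow> i < j \<Longrightarrow> j < m \<Longrightarrow> vs ! i = vs ! j \<Longrightarrow>
      Poly_Mapping.single vs 1 \<in> ext_gens scale m"

definition ext_rels ::
    "('k::field \<Rightarrow> 'v::ab_group_add \<Rightarrow> 'v) \<Rightarrow> nat \<Rightarrow> ('v list \<Rightarrow>\<^sub>0 'k) set"
  where "ext_rels scale m = module.span pm_scale (ext_gens scale m)"

definition ext_eq ::
    "('k::field \<Rightarrow> 'v::ab_group_add \<Rightarrow> 'v) \<Rightarrow> nat \<Rightarrow> (('v list \<Rightarrow>\<^sub>0 'k) \<times> ('v list \<Rightarrow>\<^sub>0 'k)) set"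
  where "ext_eq scale m = {(f, h). f \<in> free_pow m \<and> h \<in> free_pow m \<and> f - h \<in> ext_rels scale m}"

definition ext_power ::
    "('k::field \<Rightarrow> 'v::ab_group_add \<Rightarrow> 'v) \<Rightarrow> nat \<Rightarrow> ('v list \<Rightarrow>\<^sub>0 'k) set set"
  where "ext_power scale m = free_pow m // ext_eq scale m"

definition ext_class ::
    "('k::field \<Rightarrow> 'v::ab_group_add \<Rightarrow> 'v) \<Rightarrow> nat \<Rightarrow> ('v list \<Rightarrow>\<^sub>0 'k) \<Rightarrow> ('v list \<Rightarrow>\<^sub>0 'k) set"
  where "ext_class scale m f = ext_eq scale m `` {f}"

definition wedge ::
    "('k::field \<Rightarrow> 'v::ab_group_add \<Rightarrow> 'v) \<Rightarrow> 'v list \<Rightarrow> ('v list \<Rightarrow>\<^sub>0 'k) set"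
  where "wedge scale vs = ext_class scale (length vs) (Poly_Mapping.single vs 1)"

definition ext_induced ::
    "('k::field \<Rightarrow> 'v::ab_group_add \<Rightarrow> 'v) \<Rightarrow> nat \<Rightarrow> (('v list \<Rightarrow>\<^sub>0 'k) \<Rightarrow> ('v list \<Rightarrow>\<^sub>0 'k))
      \<Rightarrow> ('v list \<Rightarrow>\<^sub>0 'k) set \<Rightarrow> ('v list \<Rightarrow>\<^sub>0 'k) set"
  where "ext_induced scale m T = (\<lambda>w\<in>ext_power scale m. \<Union>f\<in>w. ext_class scale m (T f))"

text \<open>
  On the empty list \<open>free_G\<close> is the identity and \<open>free_A\<close> is zero, so the degree-zero conventions
  need no separate clause. The outer \<open>lin_ext\<close> in \<open>ext_G\<close> and \<open>ext_A\<close> is the linear extension from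
  the group to the group algebra.
\<close>

definition free_G ::
    "('g \<Rightarrow> 'v \<Rightarrow> 'v) \<Rightarrow> 'g \<Rightarrow> ('v list \<Rightarrow>\<^sub>0 'k::field) \<Rightarrow> ('v list \<Rightarrow>\<^sub>0 'k)"
  where "free_G \<rho> g = lin_ext (\<lambda>vs. Poly_Mapping.single (map (\<rho> g) vs) 1)"

definition free_A ::
    "('g \<Rightarrow> 'v \<Rightarrow> 'v) \<Rightarrow> 'g \<Rightarrow> ('v list \<Rightarrow>\<^sub>0 'k::field) \<Rightarrow> ('v list \<Rightarrow>\<^sub>0 'k)"
  where "free_A \<rho> g =
    lin_ext (\<lambda>vs. \<Sum>p<length vs. Poly_Mapping.single (vs[p := \<rho> g (vs ! p)]) 1)"

definition ext_G ::
    "('k::field \<Rightarrow> 'v::ab_group_add \<Rightarrow> 'v) \<Rightarrow> ('g::group_add \<Rightarrow> 'v \<Rightarrow> 'v) \<Rightarrow> nat \<Rightarrow> ('g \<Rightarrow>\<^sub>0 'k)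
      \<Rightarrow> ('v list \<Rightarrow>\<^sub>0 'k) set \<Rightarrow> ('v list \<Rightarrow>\<^sub>0 'k) set"
  where "ext_G scale \<rho> m x = ext_induced scale m (\<lambda>f. lin_ext (\<lambda>g. free_G \<rho> g f) x)"

definition ext_A ::
    "('k::field \<Rightarrow> 'v::ab_group_add \<Rightarrow> 'v) \<Rightarrow> ('g::group_add \<Rightarrow> 'v \<Rightarrow> 'v) \<Rightarrow> nat \<Rightarrow> ('g \<Rightarrow>\<^sub>0 'k)
      \<Rightarrow> ('v list \<Rightarrow>\<^sub>0 'k) set \<Rightarrow> ('v list \<Rightarrow>\<^sub>0 'k) set"
  where "ext_A scale \<rho> m x = ext_induced scale m (\<lambda>f. lin_ext (\<lambda>g. free_A \<rho> g f) x)"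

definition lie_elements ::
    "('k::field \<Rightarrow> 'v::ab_group_add \<Rightarrow> 'v) \<Rightarrow> ('g::group_add \<Rightarrow> 'v \<Rightarrow> 'v) \<Rightarrow> ('g \<Rightarrow>\<^sub>0 'k) set"
  where "lie_elements scale \<rho> =
    {x. \<forall>m \<le> vector_space.dim scale (UNIV :: 'v set). ext_G scale \<rho> m x = ext_A scale \<rho> m x}"

definition commutator :: "'r::ring \<Rightarrow> 'r \<Rightarrow> 'r"
  where "commutator p q = p * q - q * p"

definition lie_subalgebra ::
    "('k::field \<Rightarrow> 'l::ab_group_add \<Rightarrow> 'l) \<Rightarrow> ('l \<Rightarrow> 'l \<Rightarrow> 'l) \<Rightarrow> 'l set \<Rightarrow> bool"
  where "lie_subalgebra scale bracket L \<longleftrightarrow>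
    module.subspace scale L \<and> (\<forall>p\<in>L. \<forall>q\<in>L. bracket p q \<in> L)"

text \<open>
  \<open>ext_induced\<close> is meaningful only if the operator respects the relations; \<open>ext_G_class\<close> and
  \<open>ext_A_class\<close> establish this, and with it the defining formulas on \<open>v\<^sub>1 \<and> \<dots> \<and> v\<^sub>m\<close>.
\<close>

lemma lookup_pm_scale [simp]: "Poly_Mapping.lookup (pm_scale c f) a = c * Poly_Mapping.lookup f a"
  unfolding pm_scale_def by (simp add: Poly_Mapping.map.rep_eq when_def)

interpretation pm: vector_space "pm_scale :: 'k::field \<Rightarrow> ('a \<Rightarrow>\<^sub>0 'k) \<Rightarrow> ('a \<Rightarrow>\<^sub>0 'k)"
  by unfold_locales (auto intro!: poly_mapping_eqI simp: lookup_add algebra_simps)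

lemma lin_ext_superset:
  assumes "finite S" "Poly_Mapping.keys f \<subseteq> S"
  shows "lin_ext \<phi> f = (\<Sum>a\<in>S. pm_scale (Poly_Mapping.lookup f a) (\<phi> a))"
  unfolding lin_ext_def by (rule sum.mono_neutral_left) (use assms in \<open>auto simp: in_keys_iff\<close>)

lemma lin_ext_add: "lin_ext \<phi> (f + h) = lin_ext \<phi> f + lin_ext \<phi> h"
proof -
  let ?S = "Poly_Mapping.keys f \<union> Poly_Mapping.keys h"
  have "lin_ext \<phi> u = (\<Sum>a\<in>?S. pm_scale (Poly_Mapping.lookup u a) (\<phi> a))"
    if "u \<in> {f, h, f + h}" for u
    using that keys_add[of f h] by (intro lin_ext_superset) auto
  then show ?thesis
    by (simp add: lookup_add pm.scale_left_distrib sum.distrib)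
qed

lemma lin_ext_scale: "lin_ext \<phi> (pm_scale c f) = pm_scale c (lin_ext \<phi> f)"
proof -
  have "Poly_Mapping.keys (pm_scale c f) \<subseteq> Poly_Mapping.keys f"
    by (auto simp: in_keys_iff)
  then have "lin_ext \<phi> (pm_scale c f)
      = (\<Sum>a\<in>Poly_Mapping.keys f. pm_scale (Poly_Mapping.lookup (pm_scale c f) a) (\<phi> a))"
    by (intro lin_ext_superset) auto
  then show ?thesis
    by (simp add: lin_ext_def pm.scale_sum_right)
qed

lemma linear_lin_ext: "Vector_Spaces.linear pm_scale pm_scale (lin_ext \<phi>)"
  by (intro Vector_Spaces.linear.intro module_hom.intro module_hom_axioms.intro)
    (unfold_locales, auto simp: lin_ext_add lin_ext_scale)

lemma lin_ext_single [simp]: "lin_ext \<phi> (Poly_Mapping.single a 1) = \<phi> a"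
  by (simp add: lin_ext_def)

lemma lin_ext_diff: "lin_ext \<phi> (f - h) = lin_ext \<phi> f - lin_ext \<phi> h"
  using lin_ext_add[of \<phi> "f - h" h] by simp

lemma lin_ext_fun_diff: "lin_ext (\<lambda>g. \<phi> g - \<psi> g) x = lin_ext \<phi> x - lin_ext \<psi> x"
  by (simp add: lin_ext_def pm.scale_right_diff_distrib sum_subtractf)

lemma subspace_free_pow: "pm.subspace (free_pow m)"
  unfolding pm.subspace_def free_pow_def
  using keys_add by (fastforce simp: in_keys_iff)

lemma single_free_pow: "length vs = m \<Longrightarrow> Poly_Mapping.single vs 1 \<in> free_pow m"
  by (simp add: free_pow_def)

lemma subspace_ext_rels: "pm.subspace (ext_rels scale m)"
  by (simp add: ext_rels_def)

lemma gen_in_rels: "f \<in> ext_gens scale m \<Longrightarrow> f \<in> ext_rels scale m"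
  by (simp add: ext_rels_def pm.span_base)

lemma lin_ext_in_subspace:
  assumes "pm.subspace S" "\<And>a. a \<in> Poly_Mapping.keys f \<Longrightarrow> \<phi> a \<in> S"
  shows "lin_ext \<phi> f \<in> S"
  unfolding lin_ext_def using assms by (intro pm.subspace_sum pm.subspace_scale) auto

lemma lin_ext_rels:
  assumes "\<And>r. r \<in> ext_gens scale m \<Longrightarrow> lin_ext \<phi> r \<in> ext_rels scale m"
    and "f \<in> ext_rels scale m"
  shows "lin_ext \<phi> f \<in> ext_rels scale m"
  using assms(2) unfolding ext_rels_def
proof (induction rule: pm.span_induct_alt)
  case base
  then show ?case by (simp add: lin_ext_def pm.span_zero)
next
  case (step c x y)
  then show ?case
    using assms(1)[OF step(1)] unfolding lin_ext_add lin_ext_scale ext_rels_def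
    by (intro pm.span_add pm.span_scale)
qed

lemma equiv_ext_eq: "equiv (free_pow m) (ext_eq scale m)"
proof (rule equivI)
  note S = subspace_ext_rels[of scale m]
  show "ext_eq scale m \<subseteq> free_pow m \<times> free_pow m"
    by (auto simp: ext_eq_def)
  show "refl_on (free_pow m) (ext_eq scale m)"
    using pm.subspace_0[OF S] by (auto simp: ext_eq_def refl_on_def)
  show "sym (ext_eq scale m)"
    using pm.subspace_neg[OF S] by (fastforce simp: ext_eq_def sym_def)
  show "trans (ext_eq scale m)"
    using pm.subspace_add[OF S] by (fastforce simp: ext_eq_def trans_def)
qed

lemma ext_class_eq_iff:
  assumes "f \<in> free_pow m" "h \<in> free_pow m"
  shows "ext_class scale m f = ext_class scale m h \<longleftrightarrow> f - h \<in> ext_rels scale m"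
  unfolding ext_class_def using eq_equiv_class_iff[OF equiv_ext_eq assms] assms
  by (auto simp: ext_eq_def)

lemma ext_class_in_power: "f \<in> free_pow m \<Longrightarrow> ext_class scale m f \<in> ext_power scale m"
  by (simp add: ext_class_def ext_power_def quotientI)

lemma ext_rels_0: "ext_rels scale 0 = {0}"
proof -
  have "ext_gens scale 0 = {}"
    by (auto elim: ext_gens.cases)
  then show ?thesis by (simp add: ext_rels_def)
qed

lemma ext_induced_class:
  assumes "\<And>f. f \<in> free_pow m \<Longrightarrow> T f \<in> free_pow m"
    and "\<And>f h. T (f - h) = T f - T h"
    and "\<And>f. f \<in> ext_rels scale m \<Longrightarrow> T f \<in> ext_rels scale m"
    and f: "f \<in> free_pow m"
  shows "ext_induced scale m T (ext_class scale m f) = ext_class scale m (T f)"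
proof -
  have "(\<lambda>f. ext_class scale m (T f)) respects ext_eq scale m"
  proof (rule congruentI)
    fix u v assume "(u, v) \<in> ext_eq scale m"
    then have "u \<in> free_pow m" "v \<in> free_pow m" "u - v \<in> ext_rels scale m"
      by (auto simp: ext_eq_def)
    then show "ext_class scale m (T u) = ext_class scale m (T v)"
      using assms(1,2,3) by (metis ext_class_eq_iff)
  qed
  from UN_equiv_class[OF equiv_ext_eq this f] show ?thesis
    using ext_class_in_power[OF f, of scale] by (simp add: ext_induced_def ext_class_def)
qed

lemma ext_rels_swap:
  assumes "length vs = m" "i < j" "j < m"
  shows "Poly_Mapping.single (vs[i := a, j := b]) 1 + Poly_Mapping.single (vs[i := b, j := a]) 1
    \<in> ext_rels scale m"
proof -
  define s where "s x y = Poly_Mapping.single (vs[i := x, j := y]) (1::'b)" for x y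
  note S = subspace_ext_rels[of scale m]
  have alt: "s x x \<in> ext_rels scale m" for x
    unfolding s_def using assms by (intro gen_in_rels ext_gens.alt[of _ _ i j]) auto
  have l: "s (x + y) z - (s x z + s y z) \<in> ext_rels scale m" for x y z
    using gen_in_rels[OF ext_gens.add[of "vs[j := z]" m i x y scale]] assms
    by (simp add: s_def list_update_swap[of j i])
  have r: "s z (x + y) - (s z x + s z y) \<in> ext_rels scale m" for x y z
    using gen_in_rels[OF ext_gens.add[of "vs[i := z]" m j x y scale]] assms
    by (simp add: s_def)
  have "s a b + s b a = s (a + b) (a + b) - (s (a + b) (a + b) - (s a (a + b) + s b (a + b)))
      - (s a (a + b) - (s a a + s a b)) - (s b (a + b) - (s b a + s b b)) - s a a - s b b"
    by simp
  also have "\<dots> \<in> ext_rels scale m"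
    by (intro pm.subspace_diff[OF S] alt l r)
  finally show ?thesis by (simp add: s_def)
qed

context fd_representation
begin

lemma rep_add: "\<rho> g (a + b) = \<rho> g a + \<rho> g b"
  using rep_linear[of g] by (simp add: Vector_Spaces.linear_iff)

lemma rep_scale: "\<rho> g (scale c a) = scale c (\<rho> g a)"
  using rep_linear[of g] by (simp add: Vector_Spaces.linear_iff)

lemma free_G_pow: "f \<in> free_pow m \<Longrightarrow> free_G \<rho> g f \<in> free_pow m"
  unfolding free_G_def
  by (rule lin_ext_in_subspace[OF subspace_free_pow]) (auto simp: free_pow_def)

lemma free_A_pow: "f \<in> free_pow m \<Longrightarrow> free_A \<rho> g f \<in> free_pow m"
  unfolding free_A_def
  by (intro lin_ext_in_subspace[OF subspace_free_pow] pm.subspace_sum[OF subspace_free_pow]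
      single_free_pow) (auto simp: free_pow_def)

lemma free_G_rels: "f \<in> ext_rels scale m \<Longrightarrow> free_G \<rho> g f \<in> ext_rels scale m"
  unfolding free_G_def
proof (erule lin_ext_rels[rotated])
  fix r assume "r \<in> ext_gens scale m"
  then show "lin_ext (\<lambda>vs. Poly_Mapping.single (map (\<rho> g) vs) 1) r \<in> ext_rels scale m"
  proof cases
    case (add vs i a b)
    then show ?thesis
      using gen_in_rels[OF ext_gens.add[of "map (\<rho> g) vs" m i "\<rho> g a" "\<rho> g b" scale]]
      by (simp add: lin_ext_diff lin_ext_add map_update rep_add)
  next
    case (scale vs i c a)
    then show ?thesis
      using gen_in_rels[OF ext_gens.scale[of "map (\<rho> g) vs" m i scale c "\<rho> g a"]]
      by (simp add: lin_ext_diff lin_ext_scale map_update rep_scale)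
  next
    case (alt vs i j)
    then show ?thesis
      using gen_in_rels[OF ext_gens.alt[of "map (\<rho> g) vs" m i j scale]] by simp
  qed
qed

lemma free_A_rels: "f \<in> ext_rels scale m \<Longrightarrow> free_A \<rho> g f \<in> ext_rels scale m"
  unfolding free_A_def
proof (erule lin_ext_rels[rotated])
  note S = subspace_ext_rels[of scale m]
  let ?t = "\<lambda>vs p. Poly_Mapping.single (vs[p := \<rho> g (vs ! p)]) (1::'k)"
  fix r assume "r \<in> ext_gens scale m"
  then show "lin_ext (\<lambda>vs. \<Sum>p<length vs. ?t vs p) r \<in> ext_rels scale m"
  proof cases
    case (add vs i a b)
    have "?t (vs[i := a + b]) p - (?t (vs[i := a]) p + ?t (vs[i := b]) p) \<in> ext_rels scale m"
      if "p < m" for p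
    proof (cases "p = i")
      case True
      then show ?thesis
        using add gen_in_rels[OF ext_gens.add[of vs m i "\<rho> g a" "\<rho> g b" scale]]
        by (simp add: rep_add)
    next
      case False
      then show ?thesis
        using add that gen_in_rels[OF ext_gens.add[of "vs[p := \<rho> g (vs ! p)]" m i a b scale]]
        by (simp add: list_update_swap[of p i])
    qed
    then have "(\<Sum>p<m. ?t (vs[i := a + b]) p - (?t (vs[i := a]) p + ?t (vs[i := b]) p))
        \<in> ext_rels scale m"
      by (intro pm.subspace_sum[OF S]) auto
    then show ?thesis
      using add by (simp add: lin_ext_diff lin_ext_add sum_subtractf sum.distrib)
  next
    case (scale vs i c a)
    have "?t (vs[i := scale c a]) p - pm_scale c (?t (vs[i := a]) p) \<in> ext_rels scale m"
      if "p < m" for p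
    proof (cases "p = i")
      case True
      then show ?thesis
        using scale gen_in_rels[OF ext_gens.scale[of vs m i scale c "\<rho> g a"]]
        by (simp add: rep_scale)
    next
      case False
      then show ?thesis
        using scale that gen_in_rels[OF ext_gens.scale[of "vs[p := \<rho> g (vs ! p)]" m i scale c a]]
        by (simp add: list_update_swap[of p i])
    qed
    then have "(\<Sum>p<m. ?t (vs[i := scale c a]) p - pm_scale c (?t (vs[i := a]) p))
        \<in> ext_rels scale m"
      by (intro pm.subspace_sum[OF S]) auto
    then show ?thesis
      using scale by (simp add: lin_ext_diff lin_ext_scale sum_subtractf pm.scale_sum_right)
  next
    case (alt vs i j)
    have "(\<Sum>p<m. ?t vs p) = (\<Sum>p\<in>{..<m} - {i, j}. ?t vs p) + (\<Sum>p\<in>{i, j}. ?t vs p)"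
      using alt by (intro sum.subset_diff) auto
    also have "\<dots> = (\<Sum>p\<in>{..<m} - {i, j}. ?t vs p) + (?t vs i + ?t vs j)"
      using alt by simp
    also have "\<dots> \<in> ext_rels scale m"
    proof (rule pm.subspace_add[OF S])
      show "(\<Sum>p\<in>{..<m} - {i, j}. ?t vs p) \<in> ext_rels scale m"
        using alt by (intro pm.subspace_sum[OF S] gen_in_rels ext_gens.alt[of _ _ i j]) auto
    next
      let ?v = "vs ! i"
      have "vs[i := \<rho> g ?v] = vs[i := \<rho> g ?v, j := ?v]" "vs[j := \<rho> g ?v] = vs[i := ?v, j := \<rho> g ?v]"
        using alt by (auto intro!: nth_equalityI simp: nth_list_update)
      then show "?t vs i + ?t vs j \<in> ext_rels scale m"
        using ext_rels_swap[of vs m i j "\<rho> g ?v" ?v scale] alt by simp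
    qed
    finally show ?thesis using alt by simp
  qed
qed

lemma free_G_diff: "free_G \<rho> g (f - h) = free_G \<rho> g f - free_G \<rho> g h"
  by (simp add: free_G_def lin_ext_diff)

lemma free_A_diff: "free_A \<rho> g (f - h) = free_A \<rho> g f - free_A \<rho> g h"
  by (simp add: free_A_def lin_ext_diff)

lemma ext_G_class:
  assumes "f \<in> free_pow m"
  shows "ext_G scale \<rho> m x (ext_class scale m f)
    = ext_class scale m (lin_ext (\<lambda>g. free_G \<rho> g f) x)"
  unfolding ext_G_def
  by (rule ext_induced_class)
    (auto intro!: assms lin_ext_in_subspace subspace_free_pow subspace_ext_rels
      free_G_pow free_G_rels simp: lin_ext_fun_diff[symmetric] free_G_diff)

lemma ext_A_class:
  assumes "f \<in> free_pow m"
  shows "ext_A scale \<rho> m x (ext_class scale m f)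
    = ext_class scale m (lin_ext (\<lambda>g. free_A \<rho> g f) x)"
  unfolding ext_A_def
  by (rule ext_induced_class)
    (auto intro!: assms lin_ext_in_subspace subspace_free_pow subspace_ext_rels
      free_A_pow free_A_rels simp: lin_ext_fun_diff[symmetric] free_A_diff)

lemma ext_G_wedge:
  "ext_G scale \<rho> (length vs) (Poly_Mapping.single g 1) (wedge scale vs) = wedge scale (map (\<rho> g) vs)"
  by (simp add: wedge_def ext_G_class single_free_pow free_G_def)

lemma ext_A_wedge:
  "ext_A scale \<rho> (length vs) (Poly_Mapping.single g 1) (wedge scale vs)
    = ext_class scale (length vs)
        (\<Sum>p<length vs. Poly_Mapping.single (vs[p := \<rho> g (vs ! p)]) 1)"
  by (simp add: wedge_def ext_A_class single_free_pow free_A_def)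

end

end

theory Submission
  imports Defs
begin

text \<open>
  \<open>\<G>\<^sub>m\<close> is multiplicative and \<open>\<A>\<^sub>m\<close> preserves commutators, because in
  \<open>\<A>\<^sub>m\<langle>g\<rangle>\<A>\<^sub>m\<langle>h\<rangle>\<close> the terms where \<open>g\<close> and \<open>h\<close> act on different factors are symmetric in \<open>g\<close> and \<open>h\<close>.
  So if \<open>\<G>\<^sub>m\<close> and \<open>\<A>\<^sub>m\<close> agree on \<open>p\<close> and \<open>q\<close>, they agree on \<open>pq - qp\<close>. Both identities hold already
  in the free vector space on lists; only the equality \<open>\<G>\<^sub>m = \<A>\<^sub>m\<close> is taken modulo the relations.
\<close>

lemma lin_ext_zero: "lin_ext \<phi> 0 = 0"
  by (simp add: lin_ext_def)

lemma lin_ext_single_scale: "lin_ext \<phi> (Poly_Mapping.single a c) = pm_scale c (\<phi> a)"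
  by (cases "c = 0") (simp_all add: lin_ext_def)

text \<open>A finitely supported function is the sum of its singletons, so an identity linear in
  \<open>x\<close> need only be checked on multiples of basis elements.\<close>

lemma poly_mapping_single_induct:
  fixes x :: "'a \<Rightarrow>\<^sub>0 'k::field"
  assumes "P 0" "\<And>a c. P (Poly_Mapping.single a c)" "\<And>x y. P x \<Longrightarrow> P y \<Longrightarrow> P (x + y)"
  shows "P x"
proof -
  have "P (\<Sum>a\<in>S. Poly_Mapping.single a (Poly_Mapping.lookup x a))" if "finite S" for S
    using that by induction (auto intro: assms)
  then have "P (\<Sum>a\<in>Poly_Mapping.keys x. Poly_Mapping.single a (Poly_Mapping.lookup x a))"
    by simp
  moreover have "(\<Sum>a\<in>Poly_Mapping.keys x. Poly_Mapping.single a (Poly_Mapping.lookup x a)) = x"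
    by (rule poly_mapping_eqI) (auto simp: lookup_sum lookup_single when_def in_keys_iff)
  ultimately show ?thesis
    by simp
qed

lemma lin_ext_fun_add: "lin_ext (\<lambda>g. \<phi> g + \<psi> g) x = lin_ext \<phi> x + lin_ext \<psi> x"
  by (simp add: lin_ext_def pm.scale_right_distrib sum.distrib)

lemma lin_ext_fun_scale: "lin_ext (\<lambda>g. pm_scale c (\<phi> g)) x = pm_scale c (lin_ext \<phi> x)"
  by (simp add: lin_ext_def pm.scale_sum_right mult.commute)

lemma lin_ext_lin_ext: "lin_ext \<psi> (lin_ext \<phi> x) = lin_ext (\<lambda>a. lin_ext \<psi> (\<phi> a)) x"
  by (induction x rule: poly_mapping_single_induct)
    (simp_all add: lin_ext_zero lin_ext_single_scale lin_ext_scale lin_ext_add)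

lemma lin_ext_swap:
  "lin_ext (\<lambda>a. lin_ext (\<lambda>b. \<phi> a b) y) x = lin_ext (\<lambda>b. lin_ext (\<lambda>a. \<phi> a b) x) y"
  by (induction x rule: poly_mapping_single_induct)
    (simp_all add: lin_ext_zero lin_ext_single_scale lin_ext_add lin_ext_fun_add lin_ext_fun_scale
      lin_ext_def[of "\<lambda>b. 0"])

text \<open>Both sides are bilinear in \<open>x\<close> and \<open>y\<close> and agree on group
  elements, where \<open>mult_single\<close> evaluates the convolution.\<close>

lemma lin_ext_mult:
  "lin_ext \<phi> (x * y) = lin_ext (\<lambda>g. lin_ext (\<lambda>h. \<phi> (g + h)) y) x"
proof (induction x rule: poly_mapping_single_induct)
  case (2 g c)
  then show ?case
    by (induction y rule: poly_mapping_single_induct)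
      (simp_all add: lin_ext_zero lin_ext_single_scale lin_ext_add mult_single distrib_left
        pm.scale_right_distrib)
qed (simp_all add: lin_ext_zero lin_ext_add distrib_right)

text \<open>The lift of \<G>_m to lists of all lengths at once: the degree enters only through
  \<open>free_pow m\<close>, and equations can be proved without equivalence classes.
  \<open>alg_A\<close> lifts \<A>_m in the same way.\<close>

definition alg_G ::
    "('g::group_add \<Rightarrow> 'v \<Rightarrow> 'v) \<Rightarrow> ('g \<Rightarrow>\<^sub>0 'k::field) \<Rightarrow> ('v list \<Rightarrow>\<^sub>0 'k) \<Rightarrow> ('v list \<Rightarrow>\<^sub>0 'k)"
  where "alg_G \<rho> x f = lin_ext (\<lambda>g. free_G \<rho> g f) x"

definition alg_A ::
    "('g::group_add \<Rightarrow> 'v \<Rightarrow> 'v) \<Rightarrow> ('g \<Rightarrow>\<^sub>0 'k::field) \<Rightarrow> ('v list \<Rightarrow>\<^sub>0 'k) \<Rightarrow> ('v list \<Rightarrow>\<^sub>0 'k)"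
  where "alg_A \<rho> x f = lin_ext (\<lambda>g. free_A \<rho> g f) x"

context fd_representation
begin

lemma free_G_free_G: "free_G \<rho> g (free_G \<rho> h f) = free_G \<rho> (g + h) f"
  by (simp add: free_G_def lin_ext_lin_ext rep_mult)

lemma free_A_commutator:
  fixes f :: "'v list \<Rightarrow>\<^sub>0 'k"
  shows "free_A \<rho> g (free_A \<rho> h f) - free_A \<rho> h (free_A \<rho> g f)
    = free_A \<rho> (g + h) f - free_A \<rho> (h + g) f"
proof -
  \<comment> \<open>First \<open>h\<close> acts at place \<open>p\<close>, then \<open>g\<close> at
    place \<open>q\<close> of the updated list. For \<open>p = q\<close> this gives the action of
    \<open>g + h\<close> at \<open>p\<close>, the diagonal term \<open>d (g + h) vs p\<close>;
    \<open>off\<close> collects the other terms.\<close>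
  define t where "t g h vs p q =
      Poly_Mapping.single (vs[p := \<rho> h (vs ! p), q := \<rho> g (vs[p := \<rho> h (vs ! p)] ! q)]) (1::'k)"
    for g h vs p q
  define d where "d g vs p = Poly_Mapping.single (vs[p := \<rho> g (vs ! p)]) (1::'k)" for g vs p
  define off where "off g h vs = (\<Sum>p<length vs. \<Sum>q\<in>{..<length vs} - {p}. t g h vs p q)" for g h vs
  have lin_sum: "lin_ext \<phi> (\<Sum>p\<in>S. F p) = (\<Sum>p\<in>S. lin_ext \<phi> (F p))"
    for \<phi> :: "'v list \<Rightarrow> ('v list \<Rightarrow>\<^sub>0 'k)" and F and S :: "nat set"
    by (induction S rule: infinite_finite_induct) (simp_all add: lin_ext_zero lin_ext_add)
  have comp: "free_A \<rho> g (free_A \<rho> h f) =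
      lin_ext (\<lambda>vs. (\<Sum>p<length vs. d (g + h) vs p) + off g h vs) f" for g h
  proof -
    have split: "(\<Sum>q<length vs. t g h vs p q)
        = d (g + h) vs p + (\<Sum>q\<in>{..<length vs} - {p}. t g h vs p q)" if "p < length vs" for vs p
      using that by (subst sum.remove[of _ p]) (simp_all add: t_def d_def rep_mult)
    have "free_A \<rho> g (free_A \<rho> h f) =
        lin_ext (\<lambda>vs. \<Sum>p<length vs. \<Sum>q<length vs. t g h vs p q) f"
      by (simp add: free_A_def lin_ext_lin_ext lin_sum t_def)
    then show ?thesis
      by (simp add: split sum.distrib off_def)
  qed
  have sym: "off g h vs = off h g vs" for vs
  proof -
    \<comment> \<open>Once the sums are exchanged, the terms match because updates at distinct
      places commute.\<close>
    have "off g h vs = (\<Sum>q<length vs. \<Sum>p\<in>{p\<in>{..<length vs}. p \<noteq> q}. t g h vs p q)"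
      unfolding off_def by (subst sum.swap_restrict[symmetric]) (auto intro!: sum.cong)
    also have "\<dots> = off h g vs"
      unfolding off_def
      by (intro sum.cong) (auto simp: t_def list_update_swap)
    finally show ?thesis .
  qed
  show ?thesis
    by (simp add: comp lin_ext_fun_add sym) (simp add: free_A_def d_def)
qed

lemma alg_G_mult: "alg_G \<rho> (x * y) f = alg_G \<rho> x (alg_G \<rho> y f)"
  unfolding alg_G_def lin_ext_mult
  by (simp add: free_G_free_G[symmetric]) (simp add: free_G_def lin_ext_lin_ext)

lemma alg_A_comp: "alg_A \<rho> x (alg_A \<rho> y f)
    = lin_ext (\<lambda>g. lin_ext (\<lambda>h. free_A \<rho> g (free_A \<rho> h f)) y) x"
  by (simp add: alg_A_def free_A_def lin_ext_lin_ext)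

lemma alg_A_commutator:
  fixes f :: "'v list \<Rightarrow>\<^sub>0 'k"
  shows "alg_A \<rho> (commutator x y) f = alg_A \<rho> x (alg_A \<rho> y f) - alg_A \<rho> y (alg_A \<rho> x f)"
proof -
  have "alg_A \<rho> (commutator x y) f
      = lin_ext (\<lambda>g. lin_ext (\<lambda>h. free_A \<rho> (g + h) f - free_A \<rho> (h + g) f) y) x"
    \<comment> \<open>Expanding \<open>y * x\<close> puts \<open>y\<close> in the outer extension;
      \<open>lin_ext_swap\<close> moves \<open>x\<close> outside, so that both products share one
      double extension.\<close>
    unfolding alg_A_def commutator_def lin_ext_diff lin_ext_mult
    by (simp add: lin_ext_fun_diff lin_ext_swap[of _ x y])
  also have "\<dots> = alg_A \<rho> x (alg_A \<rho> y f) - alg_A \<rho> y (alg_A \<rho> x f)"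
    unfolding alg_A_comp free_A_commutator[symmetric] lin_ext_fun_diff
    by (simp add: lin_ext_swap[of _ x y])
  finally show ?thesis .
qed

lemma alg_G_diff: "alg_G \<rho> x (f - h) = alg_G \<rho> x f - alg_G \<rho> x h"
  by (simp add: alg_G_def free_G_diff lin_ext_fun_diff)

lemma alg_G_rels: "f \<in> ext_rels scale m \<Longrightarrow> alg_G \<rho> x f \<in> ext_rels scale m"
  unfolding alg_G_def by (intro lin_ext_in_subspace subspace_ext_rels free_G_rels)

lemma alg_G_pow: "f \<in> free_pow m \<Longrightarrow> alg_G \<rho> x f \<in> free_pow m"
  unfolding alg_G_def by (intro lin_ext_in_subspace subspace_free_pow free_G_pow)

lemma alg_A_pow: "f \<in> free_pow m \<Longrightarrow> alg_A \<rho> x f \<in> free_pow m"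
  unfolding alg_A_def by (intro lin_ext_in_subspace subspace_free_pow free_A_pow)

lemma ext_G_eq_ext_A_iff:
  "ext_G scale \<rho> m x = ext_A scale \<rho> m x \<longleftrightarrow>
    (\<forall>f\<in>free_pow m. alg_G \<rho> x f - alg_A \<rho> x f \<in> ext_rels scale m)" (is "?L \<longleftrightarrow> ?R")
proof -
  \<comment> \<open>Outside \<open>ext_power scale m\<close> both operators take the value
    \<open>undefined\<close>.\<close>
  have "?L \<longleftrightarrow> (\<forall>w\<in>ext_power scale m. ext_G scale \<rho> m x w = ext_A scale \<rho> m x w)"
    by (auto simp: ext_G_def ext_A_def ext_induced_def restrict_def fun_eq_iff)
  also have "\<dots> \<longleftrightarrow> (\<forall>f\<in>free_pow m. ext_G scale \<rho> m x (ext_class scale m f)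
      = ext_A scale \<rho> m x (ext_class scale m f))"
    by (auto simp: ext_power_def quotient_def ext_class_def)
  also have "\<dots> \<longleftrightarrow> ?R"
    by (simp add: ext_G_class ext_A_class ext_class_eq_iff alg_G_pow alg_A_pow
        flip: alg_G_def alg_A_def)
  finally show ?thesis .
qed

lemma lie_elements_iff:
  "x \<in> lie_elements scale \<rho> \<longleftrightarrow>
    (\<forall>m\<le>dim UNIV. \<forall>f\<in>free_pow m. alg_G \<rho> x f - alg_A \<rho> x f \<in> ext_rels scale m)"
  by (simp add: lie_elements_def ext_G_eq_ext_A_iff)

text \<open>The defect \<open>alg_G \<rho> x f - alg_A \<rho> x f\<close> is linear in
  \<open>x\<close>, and the relations form a subspace.\<close>

lemma subspace_lie_elements: "pm.subspace (lie_elements scale \<rho>)"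
proof (rule pm.subspaceI)
  note S = subspace_ext_rels[of scale]
  show "0 \<in> lie_elements scale \<rho>"
    by (simp add: lie_elements_iff alg_G_def alg_A_def lin_ext_zero pm.subspace_0[OF S])
  show "x + y \<in> lie_elements scale \<rho>"
    if "x \<in> lie_elements scale \<rho>" "y \<in> lie_elements scale \<rho>" for x y
    using that pm.subspace_add[OF S]
    by (fastforce simp: lie_elements_iff alg_G_def alg_A_def lin_ext_add add_diff_add)
  show "pm_scale c x \<in> lie_elements scale \<rho>" if "x \<in> lie_elements scale \<rho>" for c x
    using that pm.subspace_scale[OF S]
    by (simp add: lie_elements_iff alg_G_def alg_A_def lin_ext_scale
        flip: pm.scale_right_diff_distrib)
qed

lemma commutator_lie_elements:
  assumes x: "x \<in> lie_elements scale \<rho>" and y: "y \<in> lie_elements scale \<rho>"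
  shows "commutator x y \<in> lie_elements scale \<rho>"
  unfolding lie_elements_iff
proof (intro allI impI ballI)
  fix m and f :: "'v list \<Rightarrow>\<^sub>0 'k"
  assume m: "m \<le> dim UNIV" and f: "f \<in> free_pow m"
  note S = subspace_ext_rels[of scale m]
  have comp: "alg_G \<rho> p (alg_G \<rho> q f) - alg_A \<rho> p (alg_A \<rho> q f) \<in> ext_rels scale m"
    if "p \<in> lie_elements scale \<rho>" "q \<in> lie_elements scale \<rho>" for p q
  proof -
    \<comment> \<open>The mixed term \<open>alg_G \<rho> p (alg_A \<rho> q f)\<close> is inserted.
      The first summand is a relation since \<open>q\<close> is a Lie element and
      \<open>alg_G\<close> preserves relations, the second since \<open>p\<close> is a Lie element
      and \<open>alg_A \<rho> q f\<close> is again in \<open>free_pow m\<close>.\<close>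
    have "alg_G \<rho> p (alg_G \<rho> q f) - alg_A \<rho> p (alg_A \<rho> q f)
        = alg_G \<rho> p (alg_G \<rho> q f - alg_A \<rho> q f)
          + (alg_G \<rho> p (alg_A \<rho> q f) - alg_A \<rho> p (alg_A \<rho> q f))"
      by (simp add: alg_G_diff)
    also have "\<dots> \<in> ext_rels scale m"
      using that m f by (intro pm.subspace_add[OF S] alg_G_rels)
        (auto simp: lie_elements_iff alg_A_pow)
    finally show ?thesis .
  qed
  have "alg_G \<rho> (commutator x y) f
      = alg_G \<rho> x (alg_G \<rho> y f) - alg_G \<rho> y (alg_G \<rho> x f)"
    unfolding alg_G_mult[symmetric] by (simp add: commutator_def alg_G_def lin_ext_diff)
  then have "alg_G \<rho> (commutator x y) f - alg_A \<rho> (commutator x y) f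
      = (alg_G \<rho> x (alg_G \<rho> y f) - alg_A \<rho> x (alg_A \<rho> y f))
        - (alg_G \<rho> y (alg_G \<rho> x f) - alg_A \<rho> y (alg_A \<rho> x f))"
    by (simp add: alg_A_commutator)
  also have "\<dots> \<in> ext_rels scale m"
    by (intro pm.subspace_diff[OF S] comp x y)
  finally show "alg_G \<rho> (commutator x y) f - alg_A \<rho> (commutator x y) f \<in> ext_rels scale m" .
qed

end

theorem corollary6:
  fixes scale :: "'k::field \<Rightarrow> 'v::ab_group_add \<Rightarrow> 'v"
    and \<rho> :: "'g::group_add \<Rightarrow> 'v \<Rightarrow> 'v"
  assumes "fd_representation scale \<rho>"
  shows "lie_subalgebra (pm_scale :: 'k \<Rightarrow> ('g \<Rightarrow>\<^sub>0 'k) \<Rightarrow> ('g \<Rightarrow>\<^sub>0 'k)) commutator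
    (lie_elements scale \<rho>)"
proof -
  interpret fd_representation scale \<rho> by fact
  show ?thesis
    unfolding lie_subalgebra_def
    using subspace_lie_elements commutator_lie_elements by blast
qed

end
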